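(* Let $T$ be a traffic matrix and let $T^*=(T+T^{\top})/2$ be its symmetric counterpart. Then the projections of the sets $U(T)$, $U(T^* )$, $U^=(T^* )$, $B(2T^* )$ and $B^=(2T^* )$ onto the space of the capacity variables $y$ are all equal.
   Context: $G=(N,E)$ is a finite undirected graph with edges $\{i,j\}$, $i\neq j$; $A$ is the arc set containing both arcs $(ij)$ and $(ji)$ for each edge $\{i,j\}\in E$. $M$ is a finite set of facility types; a unit of facility $m\in M$ provides capacity $c_m\in\mathbb{Z}$, with $c_1<c_2<\dots<c_{|M|}$. $\bar c\in\mathbb{R}^E$ is the vector of existing edge capacities. $K=\{(ij)\in N\times N : i\neq j\}$ is the set of commodities. A traffic matrix is a matrix $T=\{t_{ij}\}_{i,j\in N}$ with $t_{ij}\ge 0$. For $k=(ij)\in K$ and $u\in N$, let $d_u^k=t_{ij}$ if $u=j$, $d_u^k=-t_{ij}$ if $u=i$, and $d_u^k=0$ otherwise. Flow variables are $x=(x_{ij}^k)\in\mathbb{R}^{A\times K}$, and capacity variables are $y=(y_{m,e})\in\mathbb{R}^{M\times E}$. The flow balance constraints for $T$ are $$\sum_{j:(ij)\in A} x_{ij}^k-\sum_{j:(ji)\in A}x_{ji}^k=d_i^k\quad\text{for all } k\in K,\ i\in N.$$ $U(T)$ (undirected capacity model) is the set of $(x,y)$ with $x\ge 0$, $y\ge 0$, $y\in\mathbb{Z}^{M\times E}$ satisfying the flow balance constraints for $T$ and $$\sum_{k\in K}x_{ij}^k+\sum_{k\in K}x_{ji}^k\le \bar c_e+\sum_{m\in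 M}c_m y_{m,e}\quad\text{for all } e=\{i,j\}\in E.$$ $B(T)$ (bidirected capacity model) is the set of $(x,y)$ with $x\ge 0$, $y\ge 0$, $y\in\mathbb{Z}^{M\times E}$ satisfying the flow balance constraints for $T$ and $$\max\Big\{\sum_{k\in K}x_{ij}^k,\ \sum_{k\in K}x_{ji}^k\Big\}\le \bar c_e+\sum_{m\in M}c_m y_{m,e}\quad\text{for all } e=\{i,j\}\in E.$$ $U^=(T)$ (respectively $B^=(T)$) is the set of $(x,y)\in U(T)$ (respectively $B(T)$) that also satisfy $x_{ij}^{uv}=x_{ji}^{vu}$ for all $(ij)\in A$, $(uv)\in K$. The same $G$, $M$, $c$ and $\bar c$ are used in all models. The sets $B(2T^* )$, $B^=(2T^* )$ are those for the traffic matrix $2T^*=T+T^{\top}$. *)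

theory Defs
  imports Complex_Main "HOL-Library.FuncSet"
begin

definition undirected_graph :: "'v set \<Rightarrow> 'v set set \<Rightarrow> bool" where
  "undirected_graph N E \<longleftrightarrow>
     finite N \<and> E \<subseteq> {{i, j} | i j. i \<in> N \<and> j \<in> N \<and> i \<noteq> j}"

definition arcs :: "'v set set \<Rightarrow> ('v \<times> 'v) set" where
  "arcs E = {(i, j). {i, j} \<in> E}"

definition commodities :: "'v set \<Rightarrow> ('v \<times> 'v) set" where
  "commodities N = {(i, j). i \<in> N \<and> j \<in> N \<and> i \<noteq> j}"

(* Matrices and given data vectors are total functions; their values outside the
   relevant index sets are never used. *)

type_synonym 'v matrix = "'v \<Rightarrow> 'v \<Rightarrow> real"

definition traffic_matrix :: "'v set \<Rightarrow> 'v matrix \<Rightarrow> bool" where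
  "traffic_matrix N T \<longleftrightarrow> (\<forall>i\<in>N. \<forall>j\<in>N. 0 \<le> T i j)"

definition symmetric_counterpart :: "'v matrix \<Rightarrow> 'v matrix" where
  "symmetric_counterpart T = (\<lambda>i j. (T i j + T j i) / 2)"

definition demand :: "'v matrix \<Rightarrow> 'v \<times> 'v \<Rightarrow> 'v \<Rightarrow> real" where
  "demand T k u =
     (if u = snd k then T (fst k) (snd k)
      else if u = fst k then - T (fst k) (snd k)
      else 0)"

(* Points are pairs (x, y). The vectors x and y are extensional functions on their
   index sets (PiE), so that two of them are equal iff they agree on these sets.
   The entry x ((i, j), k) is the flow of commodity k on arc (i, j); the entry
   y (m, e) is the number of units of facility m installed on edge e. *)

type_synonym 'v flow = "('v \<times> 'v) \<times> ('v \<times> 'v) \<Rightarrow> real"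
type_synonym ('m, 'v) capacity = "'m \<times> 'v set \<Rightarrow> real"

definition variable_domain ::
    "'v set \<Rightarrow> 'v set set \<Rightarrow> 'm set \<Rightarrow> ('v flow \<times> ('m, 'v) capacity) set" where
  "variable_domain N E M =
     ((arcs E \<times> commodities N) \<rightarrow>\<^sub>E {r. 0 \<le> r}) \<times> ((M \<times> E) \<rightarrow>\<^sub>E {r \<in> \<int>. 0 \<le> r})"

definition flow_balance :: "'v set \<Rightarrow> 'v set set \<Rightarrow> 'v matrix \<Rightarrow> 'v flow \<Rightarrow> bool" where
  "flow_balance N E T x \<longleftrightarrow>
     (\<forall>k\<in>commodities N. \<forall>i\<in>N.
        (\<Sum>j | (i, j) \<in> arcs E. x ((i, j), k)) - (\<Sum>j | (j, i) \<in> arcs E. x ((j, i), k))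
          = demand T k i)"

definition total_flow :: "'v set \<Rightarrow> 'v flow \<Rightarrow> 'v \<times> 'v \<Rightarrow> real" where
  "total_flow N x a = (\<Sum>k\<in>commodities N. x (a, k))"

definition edge_capacity ::
    "'m set \<Rightarrow> ('m \<Rightarrow> int) \<Rightarrow> ('v set \<Rightarrow> real) \<Rightarrow> ('m, 'v) capacity \<Rightarrow> 'v set \<Rightarrow> real" where
  "edge_capacity M c cbar y e = cbar e + (\<Sum>m\<in>M. of_int (c m) * y (m, e))"

definition undirected_model ::
    "'v set \<Rightarrow> 'v set set \<Rightarrow> 'm set \<Rightarrow> ('m \<Rightarrow> int) \<Rightarrow> ('v set \<Rightarrow> real) \<Rightarrow> 'v matrix
      \<Rightarrow> ('v flow \<times> ('m, 'v) capacity) set" where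
  "undirected_model N E M c cbar T =
     {(x, y) \<in> variable_domain N E M. flow_balance N E T x \<and>
        (\<forall>i j. {i, j} \<in> E \<longrightarrow>
           total_flow N x (i, j) + total_flow N x (j, i) \<le> edge_capacity M c cbar y {i, j})}"

definition bidirected_model ::
    "'v set \<Rightarrow> 'v set set \<Rightarrow> 'm set \<Rightarrow> ('m \<Rightarrow> int) \<Rightarrow> ('v set \<Rightarrow> real) \<Rightarrow> 'v matrix
      \<Rightarrow> ('v flow \<times> ('m, 'v) capacity) set" where
  "bidirected_model N E M c cbar T =
     {(x, y) \<in> variable_domain N E M. flow_balance N E T x \<and>
        (\<forall>i j. {i, j} \<in> E \<longrightarrow>
           max (total_flow N x (i, j)) (total_flow N x (j, i)) \<le> edge_capacity M c cbar y {i, j})}"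

definition symmetric_flow :: "'v set \<Rightarrow> 'v set set \<Rightarrow> 'v flow \<Rightarrow> bool" where
  "symmetric_flow N E x \<longleftrightarrow>
     (\<forall>(i, j)\<in>arcs E. \<forall>(u, v)\<in>commodities N. x ((i, j), (u, v)) = x ((j, i), (v, u)))"

definition undirected_model_sym ::
    "'v set \<Rightarrow> 'v set set \<Rightarrow> 'm set \<Rightarrow> ('m \<Rightarrow> int) \<Rightarrow> ('v set \<Rightarrow> real) \<Rightarrow> 'v matrix
      \<Rightarrow> ('v flow \<times> ('m, 'v) capacity) set" where
  "undirected_model_sym N E M c cbar T =
     {(x, y) \<in> undirected_model N E M c cbar T. symmetric_flow N E x}"

definition bidirected_model_sym ::
    "'v set \<Rightarrow> 'v set set \<Rightarrow> 'm set \<Rightarrow> ('m \<Rightarrow> int) \<Rightarrow> ('v set \<Rightarrow> real) \<Rightarrow> 'v matrix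
      \<Rightarrow> ('v flow \<times> ('m, 'v) capacity) set" where
  "bidirected_model_sym N E M c cbar T =
     {(x, y) \<in> bidirected_model N E M c cbar T. symmetric_flow N E x}"

end

theory Submission
  imports Defs
begin

text \<open>
  Reversing a routing and exchanging the two endpoints of every commodity turns a routing of
  \<open>S\<close> into a routing of its transpose. Adding both and scaling commodity \<open>(u, v)\<close> by a weight
  \<open>w (u, v)\<close> gives a routing of \<open>w (u, v) * (S u v + S v u)\<close>, whose total load on each edge does
  not increase as long as \<open>w (u, v) + w (v, u) \<le> 1\<close>. The weight \<open>1 / 2\<close> symmetrizes a routing,
  the weight \<open>T u v / (T u v + T v u)\<close> splits a routing of the symmetric counterpart into one of
  \<open>T\<close>, and the constants \<open>1\<close> and \<open>1 / 4\<close> pass between the undirected and the bidirected model,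
  because a symmetric routing loads both arcs of an edge equally.
\<close>

text \<open>The restricted abstraction keeps the result extensional, as the variable domain demands.
  The weight depends on the commodity only, never on the arc, so it factors out of every flow
  balance.\<close>

definition weighted_symmetrization ::
    "'v set \<Rightarrow> 'v set set \<Rightarrow> ('v \<times> 'v \<Rightarrow> real) \<Rightarrow> 'v flow \<Rightarrow> 'v flow" where
  "weighted_symmetrization N E w x =
     (\<lambda>(a, k)\<in>arcs E \<times> commodities N. w k * (x (a, k) + x (prod.swap a, prod.swap k)))"

section \<open>Reversal of arcs and commodities\<close>

lemma swap_mem_arcs_iff: "(j, i) \<in> arcs E \<longleftrightarrow> (i, j) \<in> arcs E"
  by (simp add: arcs_def insert_commute)

lemma swap_mem_commodities_iff: "(v, u) \<in> commodities N \<longleftrightarrow> (u, v) \<in> commodities N"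
  by (auto simp: commodities_def)

lemma weighted_symmetrization_apply:
  assumes "(i, j) \<in> arcs E" "(u, v) \<in> commodities N"
  shows "weighted_symmetrization N E w x ((i, j), (u, v))
    = w (u, v) * (x ((i, j), (u, v)) + x ((j, i), (v, u)))"
  using assms by (simp add: weighted_symmetrization_def)

lemma sum_commodities_swap:
  "(\<Sum>k\<in>commodities N. f (prod.swap k)) = (\<Sum>k\<in>commodities N. f k)"
  by (rule sum.reindex_bij_witness[of _ prod.swap prod.swap])
     (auto simp: swap_mem_commodities_iff)

lemma flow_nonneg:
  assumes "(x, y) \<in> variable_domain N E M" "a \<in> arcs E" "k \<in> commodities N"
  shows "0 \<le> x (a, k)"
proof -
  have "x \<in> (arcs E \<times> commodities N) \<rightarrow>\<^sub>E {r. 0 \<le> r}"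
    using assms(1) by (simp add: variable_domain_def)
  from PiE_mem[OF this, of "(a, k)"] show ?thesis
    using assms(2,3) by simp
qed

section \<open>Model constraints under weighted symmetrization\<close>

lemma weighted_symmetrization_in_domain:
  assumes "(x, y) \<in> variable_domain N E M"
    and "\<And>k. k \<in> commodities N \<Longrightarrow> 0 \<le> w k"
  shows "(weighted_symmetrization N E w x, y) \<in> variable_domain N E M"
proof -
  have "weighted_symmetrization N E w x \<in> (arcs E \<times> commodities N) \<rightarrow>\<^sub>E {r. 0 \<le> r}"
    unfolding weighted_symmetrization_def
    by (auto simp: swap_mem_arcs_iff swap_mem_commodities_iff
        intro!: mult_nonneg_nonneg add_nonneg_nonneg assms(2) flow_nonneg[OF assms(1)])
  then show ?thesis
    using assms(1) by (simp add: variable_domain_def)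
qed

text \<open>Reversing arcs exchanges inflow and outflow, so the reversed flow of
  \<open>(v, u)\<close> has the balance of \<open>(v, u)\<close> with opposite sign. This makes it a
  flow from \<open>u\<close> to \<open>v\<close> of value \<open>S v u\<close>.\<close>

lemma flow_balance_weighted_symmetrization:
  assumes "flow_balance N E S x"
    and weight: "\<And>u v. (u, v) \<in> commodities N \<Longrightarrow> w (u, v) * (S u v + S v u) = R u v"
  shows "flow_balance N E R (weighted_symmetrization N E w x)"
  unfolding flow_balance_def
proof (intro ballI)
  fix k i assume "k \<in> commodities N" and i: "i \<in> N"
  then obtain u v where k: "k = (u, v)" and uv: "(u, v) \<in> commodities N"
    by (cases k) auto
  let ?z = "weighted_symmetrization N E w x"
  let ?out = "\<lambda>k. \<Sum>j | (i, j) \<in> arcs E. x ((i, j), k)"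
  let ?in = "\<lambda>k. \<Sum>j | (j, i) \<in> arcs E. x ((j, i), k)"
  have bal: "?out k - ?in k = demand S k i" if "k \<in> commodities N" for k
    using assms(1) that i by (simp add: flow_balance_def)
  have "(\<Sum>j | (i, j) \<in> arcs E. ?z ((i, j), (u, v)))
      = (\<Sum>j | (i, j) \<in> arcs E. w (u, v) * (x ((i, j), (u, v)) + x ((j, i), (v, u))))"
    using uv by (intro sum.cong) (simp_all add: weighted_symmetrization_apply)
  \<comment> \<open>Out-neighbours and in-neighbours of \<open>i\<close> coincide, so the second
    summands form an inflow of \<open>(v, u)\<close>.\<close>
  also have "\<dots> = w (u, v) * (?out (u, v) + ?in (v, u))"
    by (simp add: sum_distrib_left[symmetric] sum.distrib swap_mem_arcs_iff[of i])
  finally have out: "(\<Sum>j | (i, j) \<in> arcs E. ?z ((i, j), (u, v)))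
    = w (u, v) * (?out (u, v) + ?in (v, u))" .
  have "(\<Sum>j | (j, i) \<in> arcs E. ?z ((j, i), (u, v)))
      = (\<Sum>j | (j, i) \<in> arcs E. w (u, v) * (x ((j, i), (u, v)) + x ((i, j), (v, u))))"
    using uv by (intro sum.cong) (simp_all add: weighted_symmetrization_apply)
  also have "\<dots> = w (u, v) * (?in (u, v) + ?out (v, u))"
    by (simp add: sum_distrib_left[symmetric] sum.distrib swap_mem_arcs_iff[of i])
  finally have "in": "(\<Sum>j | (j, i) \<in> arcs E. ?z ((j, i), (u, v)))
    = w (u, v) * (?in (u, v) + ?out (v, u))" .
  have "(\<Sum>j | (i, j) \<in> arcs E. ?z ((i, j), k)) - (\<Sum>j | (j, i) \<in> arcs E. ?z ((j, i), k))
      = w (u, v) * ((?out (u, v) - ?in (u, v)) - (?out (v, u) - ?in (v, u)))"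
    unfolding k out "in" by (simp add: algebra_simps)
  also have "\<dots> = w (u, v) * (demand S (u, v) i - demand S (v, u) i)"
    using uv by (simp add: bal swap_mem_commodities_iff)
  also have "\<dots> = demand R k i"
    using uv weight[OF uv] by (auto simp: k demand_def commodities_def algebra_simps)
  finally show "(\<Sum>j | (i, j) \<in> arcs E. ?z ((i, j), k)) - (\<Sum>j | (j, i) \<in> arcs E. ?z ((j, i), k))
    = demand R k i" .
qed

text \<open>Reindexing the reversed part moves the swap from the flow to the weight, so that loads
  of opposite arcs can be collected commodity by commodity.\<close>

lemma total_flow_weighted_symmetrization:
  assumes "(i, j) \<in> arcs E"
  shows "total_flow N (weighted_symmetrization N E w x) (i, j)
    = (\<Sum>k\<in>commodities N. w k * x ((i, j), k))
      + (\<Sum>k\<in>commodities N. w (prod.swap k) * x ((j, i), k))"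
proof -
  have "total_flow N (weighted_symmetrization N E w x) (i, j)
      = (\<Sum>k\<in>commodities N. w k * x ((i, j), k))
        + (\<Sum>k\<in>commodities N. w k * x ((j, i), prod.swap k))"
    using assms by (simp add: total_flow_def weighted_symmetrization_def sum.distrib distrib_left)
  then show ?thesis
    using sum_commodities_swap[of "\<lambda>k. w (prod.swap k) * x ((j, i), k)" N] by simp
qed

lemma total_flow_symmetrization_const:
  assumes "(i, j) \<in> arcs E"
  shows "total_flow N (weighted_symmetrization N E (\<lambda>_. r) x) (i, j)
    = r * (total_flow N x (i, j) + total_flow N x (j, i))"
  using assms by (simp add: total_flow_weighted_symmetrization)
    (simp add: total_flow_def sum_distrib_left distrib_left)

text \<open>Each value \<open>x ((i, j), k)\<close> is counted with weight \<open>w k\<close> on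
  \<open>(i, j)\<close> and with weight \<open>w (prod.swap k)\<close> on \<open>(j, i)\<close>. As
  flows are nonnegative, it suffices that these weights sum to at most 1.\<close>

lemma edge_flow_weighted_symmetrization_le:
  assumes "(x, y) \<in> variable_domain N E M" and ij: "(i, j) \<in> arcs E"
    and weight: "\<And>k. k \<in> commodities N \<Longrightarrow> w k + w (prod.swap k) \<le> 1"
  shows "total_flow N (weighted_symmetrization N E w x) (i, j)
      + total_flow N (weighted_symmetrization N E w x) (j, i)
    \<le> total_flow N x (i, j) + total_flow N x (j, i)"
proof -
  have ji: "(j, i) \<in> arcs E"
    using ij by (simp add: swap_mem_arcs_iff)
  have "total_flow N (weighted_symmetrization N E w x) (i, j)
      + total_flow N (weighted_symmetrization N E w x) (j, i)
      = (\<Sum>k\<in>commodities N. (w k + w (prod.swap k)) * (x ((i, j), k) + x ((j, i), k)))"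
    by (simp add: total_flow_weighted_symmetrization[OF ij]
        total_flow_weighted_symmetrization[OF ji] sum.distrib[symmetric] algebra_simps)
  also have "\<dots> \<le> (\<Sum>k\<in>commodities N. 1 * (x ((i, j), k) + x ((j, i), k)))"
    by (intro sum_mono mult_right_mono weight add_nonneg_nonneg flow_nonneg[OF assms(1)] ij ji)
  finally show ?thesis
    by (simp add: total_flow_def sum.distrib)
qed

lemma symmetric_flow_symmetrization_const:
  "symmetric_flow N E (weighted_symmetrization N E (\<lambda>_. r) x)"
  by (auto simp: symmetric_flow_def weighted_symmetrization_apply swap_mem_arcs_iff
      swap_mem_commodities_iff)

text \<open>Swapping endpoints permutes the commodities, so the per-commodity symmetry survives
  summation.\<close>

lemma total_flow_symmetric:
  assumes "symmetric_flow N E x" "(i, j) \<in> arcs E"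
  shows "total_flow N x (j, i) = total_flow N x (i, j)"
proof -
  have "total_flow N x (i, j) = (\<Sum>k\<in>commodities N. x ((j, i), prod.swap k))"
    unfolding total_flow_def using assms by (intro sum.cong) (fastforce simp: symmetric_flow_def)+
  then show ?thesis
    by (simp add: total_flow_def sum_commodities_swap[of "\<lambda>k. x ((j, i), k)"])
qed

lemma undirected_model_weighted_symmetrization:
  assumes xy: "(x, y) \<in> undirected_model N E M c cbar S"
    and "\<And>k. k \<in> commodities N \<Longrightarrow> 0 \<le> w k"
    and "\<And>k. k \<in> commodities N \<Longrightarrow> w k + w (prod.swap k) \<le> 1"
    and "\<And>u v. (u, v) \<in> commodities N \<Longrightarrow> w (u, v) * (S u v + S v u) = R u v"
  shows "(weighted_symmetrization N E w x, y) \<in> undirected_model N E M c cbar R"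
proof -
  let ?z = "weighted_symmetrization N E w x"
  have dom: "(x, y) \<in> variable_domain N E M" and bal: "flow_balance N E S x"
    using xy by (auto simp: undirected_model_def)
  have "total_flow N ?z (i, j) + total_flow N ?z (j, i) \<le> edge_capacity M c cbar y {i, j}"
    if "{i, j} \<in> E" for i j
  proof -
    have "(i, j) \<in> arcs E"
      using that by (simp add: arcs_def)
    from edge_flow_weighted_symmetrization_le[OF dom this, of w] assms(3)
    have "total_flow N ?z (i, j) + total_flow N ?z (j, i)
        \<le> total_flow N x (i, j) + total_flow N x (j, i)"
      by blast
    also have "\<dots> \<le> edge_capacity M c cbar y {i, j}"
      using xy that by (simp add: undirected_model_def)
    finally show ?thesis .
  qed
  then show ?thesis
    using weighted_symmetrization_in_domain[OF dom, of w] assms(2)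
      flow_balance_weighted_symmetrization[OF bal, of w R] assms(4)
    by (simp add: undirected_model_def)
qed

section \<open>Inclusions between the projections\<close>

lemma snd_image_undirected_model_subset_sym:
  "snd ` undirected_model N E M c cbar T
    \<subseteq> snd ` undirected_model_sym N E M c cbar (symmetric_counterpart T)"
proof (rule image_subsetI)
  fix p assume p: "p \<in> undirected_model N E M c cbar T"
  obtain x y where xy: "p = (x, y)" by (cases p)
  have "(weighted_symmetrization N E (\<lambda>_. 1 / 2) x, y)
      \<in> undirected_model_sym N E M c cbar (symmetric_counterpart T)"
    using undirected_model_weighted_symmetrization[of x y N E M c cbar T "\<lambda>_. 1 / 2"
        "symmetric_counterpart T"] p xy
    by (simp add: undirected_model_sym_def symmetric_flow_symmetrization_const
        symmetric_counterpart_def)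
  from image_eqI[OF _ this, of "snd p" snd]
  show "snd p \<in> snd ` undirected_model_sym N E M c cbar (symmetric_counterpart T)"
    by (simp add: xy)
qed

text \<open>The symmetrized flow between \<open>u\<close> and \<open>v\<close> has value
  \<open>T u v + T v u\<close> before weighting. It is divided between the two directions in
  proportion to their demands in \<open>T\<close>; only the joint load of both arcs is
  constrained.\<close>

lemma snd_image_undirected_model_counterpart_subset:
  assumes "traffic_matrix N T"
  shows "snd ` undirected_model N E M c cbar (symmetric_counterpart T)
    \<subseteq> snd ` undirected_model N E M c cbar T"
proof (rule image_subsetI)
  fix p assume p: "p \<in> undirected_model N E M c cbar (symmetric_counterpart T)"
  obtain x y where xy: "p = (x, y)" by (cases p)
  \<comment> \<open>If both entries vanish, the quotient is \<open>0 / 0 = 0\<close>, a valid weight for a zero demand.\<close>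
  define w where "w = (\<lambda>(u, v). T u v / (T u v + T v u))"
  have T: "0 \<le> T u v" "0 \<le> T v u" if "(u, v) \<in> commodities N" for u v
    using assms that by (auto simp: traffic_matrix_def commodities_def)
  have "(weighted_symmetrization N E w x, y) \<in> undirected_model N E M c cbar T"
  proof (rule undirected_model_weighted_symmetrization)
    show "(x, y) \<in> undirected_model N E M c cbar (symmetric_counterpart T)"
      using p xy by simp
    show "0 \<le> w k" if "k \<in> commodities N" for k
      using that T by (cases k) (simp add: w_def)
    show "w k + w (prod.swap k) \<le> 1" if "k \<in> commodities N" for k
      \<comment> \<open>Both quotients share a denominator, so they sum to 1, or to 0 if it
        vanishes.\<close>
      by (cases k) (simp add: w_def add.commute add_divide_distrib[symmetric])
    show "w (u, v) * (symmetric_counterpart T u v + symmetric_counterpart T v u) = T u v"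
      if "(u, v) \<in> commodities N" for u v
      \<comment> \<open>By nonnegativity, a zero denominator forces
        \<open>T u v = 0\<close>.\<close>
      using T[OF that]
      by (cases "T u v + T v u = 0") (auto simp: w_def symmetric_counterpart_def field_simps)
  qed
  from image_eqI[OF _ this, of "snd p" snd]
  show "snd p \<in> snd ` undirected_model N E M c cbar T"
    by (simp add: xy)
qed

text \<open>Adding the reversal doubles a symmetric demand, and each arc then carries what
  \<open>x\<close> puts on both arcs of the edge together. The bidirected constraint for the sum is
  thus the undirected one for \<open>x\<close>.\<close>

lemma snd_image_undirected_model_sym_subset_bidirected:
  assumes "\<And>u v. S u v = S v u"
  shows "snd ` undirected_model_sym N E M c cbar S
    \<subseteq> snd ` bidirected_model_sym N E M c cbar (\<lambda>i j. 2 * S i j)"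
proof (rule image_subsetI)
  fix p assume p: "p \<in> undirected_model_sym N E M c cbar S"
  obtain x y where xy: "p = (x, y)" by (cases p)
  let ?z = "weighted_symmetrization N E (\<lambda>_. 1) x"
  have dom: "(x, y) \<in> variable_domain N E M" and bal: "flow_balance N E S x"
    using p xy by (auto simp: undirected_model_sym_def undirected_model_def)
  have "max (total_flow N ?z (i, j)) (total_flow N ?z (j, i)) \<le> edge_capacity M c cbar y {i, j}"
    if "{i, j} \<in> E" for i j
  proof -
    have ij: "(i, j) \<in> arcs E"
      using that by (simp add: arcs_def)
    then have "total_flow N ?z (j, i) = total_flow N ?z (i, j)"
      by (rule total_flow_symmetric[OF symmetric_flow_symmetrization_const])
    then show ?thesis
      using p xy that total_flow_symmetrization_const[OF ij, of N 1 x]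
      by (simp add: undirected_model_sym_def undirected_model_def)
  qed
  then have "(?z, y) \<in> bidirected_model_sym N E M c cbar (\<lambda>i j. 2 * S i j)"
    using weighted_symmetrization_in_domain[OF dom, of "\<lambda>_. 1"]
      flow_balance_weighted_symmetrization[OF bal, of "\<lambda>_. 1" "\<lambda>i j. 2 * S i j"] assms
    by (simp add: bidirected_model_sym_def bidirected_model_def
        symmetric_flow_symmetrization_const)
  from image_eqI[OF _ this, of "snd p" snd]
  show "snd p \<in> snd ` bidirected_model_sym N E M c cbar (\<lambda>i j. 2 * S i j)"
    by (simp add: xy)
qed

text \<open>The weight is forced by \<open>w * (2 * S u v + 2 * S v u) = S u v\<close>. The joint
  load of an edge becomes the mean of the two arc loads of \<open>x\<close>, which is at most their
  maximum.\<close>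

lemma snd_image_bidirected_model_subset_undirected_sym:
  assumes "\<And>u v. S u v = S v u"
  shows "snd ` bidirected_model N E M c cbar (\<lambda>i j. 2 * S i j)
    \<subseteq> snd ` undirected_model_sym N E M c cbar S"
proof (rule image_subsetI)
  fix p assume p: "p \<in> bidirected_model N E M c cbar (\<lambda>i j. 2 * S i j)"
  obtain x y where xy: "p = (x, y)" by (cases p)
  let ?z = "weighted_symmetrization N E (\<lambda>_. 1 / 4) x"
  have dom: "(x, y) \<in> variable_domain N E M"
    and bal: "flow_balance N E (\<lambda>i j. 2 * S i j) x"
    using p xy by (auto simp: bidirected_model_def)
  have "total_flow N ?z (i, j) + total_flow N ?z (j, i) \<le> edge_capacity M c cbar y {i, j}"
    if "{i, j} \<in> E" for i j
  proof -
    have ij: "(i, j) \<in> arcs E"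
      using that by (simp add: arcs_def)
    then have ji: "(j, i) \<in> arcs E"
      by (simp add: swap_mem_arcs_iff)
    have "total_flow N x (i, j) \<le> edge_capacity M c cbar y {i, j}"
      "total_flow N x (j, i) \<le> edge_capacity M c cbar y {i, j}"
      using p xy that by (auto simp: bidirected_model_def)
    then show ?thesis
      using total_flow_symmetrization_const[OF ij, of N "1 / 4" x]
        total_flow_symmetrization_const[OF ji, of N "1 / 4" x]
      by simp
  qed
  then have "(?z, y) \<in> undirected_model_sym N E M c cbar S"
    using weighted_symmetrization_in_domain[OF dom, of "\<lambda>_. 1 / 4"]
      flow_balance_weighted_symmetrization[OF bal, of "\<lambda>_. 1 / 4" S] assms
    by (simp add: undirected_model_sym_def undirected_model_def
        symmetric_flow_symmetrization_const)
  from image_eqI[OF _ this, of "snd p" snd]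
  show "snd p \<in> snd ` undirected_model_sym N E M c cbar S"
    by (simp add: xy)
qed

theorem corollary1:
  fixes N :: "'v set" and E :: "'v set set"
    and M :: "'m::linorder set" and c :: "'m \<Rightarrow> int" and cbar :: "'v set \<Rightarrow> real"
    and T Tstar :: "'v matrix"
  assumes "undirected_graph N E"
    and "finite M" and "strict_mono_on M c"
    and "traffic_matrix N T"
    and "Tstar = symmetric_counterpart T"
  shows "snd ` undirected_model N E M c cbar T = snd ` undirected_model N E M c cbar Tstar
    \<and> snd ` undirected_model N E M c cbar Tstar = snd ` undirected_model_sym N E M c cbar Tstar
    \<and> snd ` undirected_model_sym N E M c cbar Tstar
        = snd ` bidirected_model N E M c cbar (\<lambda>i j. 2 * Tstar i j)
    \<and> snd ` bidirected_model N E M c cbar (\<lambda>i j. 2 * Tstar i j)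
        = snd ` bidirected_model_sym N E M c cbar (\<lambda>i j. 2 * Tstar i j)"
proof -
  have sym: "Tstar u v = Tstar v u" for u v
    by (simp add: assms(5) symmetric_counterpart_def add.commute)
  \<comment> \<open>Two cycles of inclusions meet in the symmetric undirected model: one through
    both undirected models, the other through both bidirected ones.\<close>
  have "snd ` undirected_model N E M c cbar T \<subseteq> snd ` undirected_model_sym N E M c cbar Tstar"
    using snd_image_undirected_model_subset_sym by (simp add: assms(5))
  moreover have "snd ` undirected_model N E M c cbar Tstar \<subseteq> snd ` undirected_model N E M c cbar T"
    using snd_image_undirected_model_counterpart_subset[OF assms(4)] by (simp add: assms(5))
  moreover have "snd ` undirected_model_sym N E M c cbar Tstar
      \<subseteq> snd ` undirected_model N E M c cbar Tstar"
    by (intro image_mono) (auto simp: undirected_model_sym_def)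
  moreover have "snd ` bidirected_model_sym N E M c cbar (\<lambda>i j. 2 * Tstar i j)
      \<subseteq> snd ` bidirected_model N E M c cbar (\<lambda>i j. 2 * Tstar i j)"
    by (intro image_mono) (auto simp: bidirected_model_sym_def)
  moreover note snd_image_undirected_model_sym_subset_bidirected[of Tstar N E M c cbar, OF sym]
    snd_image_bidirected_model_subset_undirected_sym[of Tstar N E M c cbar, OF sym]
  ultimately show ?thesis
    by (meson order_trans subset_antisym)
qed

end
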